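(* Let $X$ be a dendrite and let $f:X\to X$ be a continuous map. Then every point of $X$ that is a recurrent point of arc type of $f$ belongs to the closure of the set of all periodic points of $f$.
   Context: A dendrite is a non-degenerate (i.e. containing more than one point) locally connected continuum (compact connected metric space) which contains no Jordan curve. For any two points $a,b$ of a dendrite $X$ there is a unique closed arc in $X$ with endpoints $a$ and $b$, denoted $[a,b]$; the notation $(a,b)$, $(a,b]$, $[a,b)$ is analogous to the interval case. Let $f:X\to X$ be a continuous self-map of a dendrite. Given points $x,b\in X$, we say that $b$ is a limit point of $x$ of arc type if there exist an arc $[a,b]\subset X$ and a sequence of images $f^{n_k}(x)\in(a,b)$ of $x$ which converge to $b$. A point $b\in X$ is a recurrent point of arc type if $b$ is a limit point of $b$ of arc type. *)

theory Defs
  imports "HOL-Analysis.Analysis"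
begin

definition jordan_curve :: "'a::topological_space set \<Rightarrow> bool" where
  "jordan_curve C \<longleftrightarrow>
     (\<exists>g. simple_path g \<and> pathfinish g = pathstart g \<and> path_image g = C)"

definition dendrite :: "'a::metric_space set \<Rightarrow> bool" where
  "dendrite X \<longleftrightarrow>
     compact X \<and> connected X \<and> locally connected X \<and>
     (\<exists>x\<in>X. \<exists>y\<in>X. x \<noteq> y) \<and>
     \<not> (\<exists>C\<subseteq>X. jordan_curve C)"

definition closed_arc :: "'a::topological_space \<Rightarrow> 'a \<Rightarrow> 'a set \<Rightarrow> bool" where
  "closed_arc a b A \<longleftrightarrow>
     (\<exists>g. arc g \<and> pathstart g = a \<and> pathfinish g = b \<and> path_image g = A)"

text \<open>
  In a dendrite the arc \<open>A\<close> below is the unique arc \<open>[a,b]\<close> in \<open>X\<close>, and \<open>A - {a, b}\<close> is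
  \<open>(a,b)\<close>. The times \<open>n k\<close> need not be required to increase: the points of the sequence are
  all different from their limit \<open>b\<close>, so \<open>n\<close> takes each value only finitely often and
  has a strictly increasing subsequence.
\<close>

definition arc_type_limit_point ::
    "'a::metric_space set \<Rightarrow> ('a \<Rightarrow> 'a) \<Rightarrow> 'a \<Rightarrow> 'a \<Rightarrow> bool" where
  "arc_type_limit_point X f x b \<longleftrightarrow>
     (\<exists>a A. closed_arc a b A \<and> A \<subseteq> X \<and>
        (\<exists>n :: nat \<Rightarrow> nat. (\<forall>k. (f ^^ n k) x \<in> A - {a, b}) \<and>
           (\<lambda>k. (f ^^ n k) x) \<longlonglongrightarrow> b))"

definition arc_type_recurrent :: "'a::metric_space set \<Rightarrow> ('a \<Rightarrow> 'a) \<Rightarrow> 'a \<Rightarrow> bool" where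
  "arc_type_recurrent X f b \<longleftrightarrow> b \<in> X \<and> arc_type_limit_point X f b b"

definition periodic_points :: "'a set \<Rightarrow> ('a \<Rightarrow> 'a) \<Rightarrow> 'a set" where
  "periodic_points X f = {x \<in> X. \<exists>n>0. (f ^^ n) x = x}"

end

theory Submission
  imports Defs
begin

text \<open>
  Parametrize the arc \<open>[a,b]\<close> by \<open>g\<close> with \<open>g 1 = b\<close>, and write \<open>seg X u v\<close> for the set of points
  lying in every connected subset of \<open>X\<close> that contains \<open>u\<close> and \<open>v\<close>; in a dendrite this is the arc
  \<open>[u,v]\<close> (\<open>seg_arc\<close>). Suppose that some ball around \<open>b\<close> contains no periodic point.

  Branches. If \<open>z = g t\<close> and \<open>f^m z\<close> lies at \<open>z\<close> or in a branch hanging off \<open>[a,b]\<close> at \<open>z\<close>, then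
  \<open>f^m\<close> has a fixed point at \<open>z\<close> or in that branch (\<open>fixed_point_in_branch\<close>, the fixed point
  property of dendrites in a localized form). The branches at \<open>z\<close> lie close to \<open>b\<close> when \<open>z\<close> does
  (\<open>branches_shrink\<close>). Hence, for \<open>z\<close> in a final open piece \<open>J\<close> of the arc, every image \<open>f^m z\<close> with
  \<open>m > 0\<close> lies off the branches at \<open>z\<close>: either on the side of \<open>a\<close> (lower) or on the side of \<open>b\<close>
  (upper). Both alternatives are open conditions on \<open>z\<close>, so by connectedness of \<open>J\<close> each \<open>m\<close> is
  lower on all of \<open>J\<close> or upper on all of \<open>J\<close>.

  Arithmetic of return times. By recurrence there are times \<open>N < N'\<close> for which \<open>x = f^N b\<close> and
  \<open>x' = f^N' b\<close> lie on the piece \<open>J\<close> of the arc with \<open>x'\<close> between \<open>x\<close> and \<open>b\<close>. Put \<open>m = N' - N\<close>, so that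
  \<open>f^m x = x'\<close> and \<open>m\<close> is upper. If \<open>j m\<close> is upper, then \<open>f^(j m)\<close> moves \<open>x'\<close> further up, so \<open>f^((j+1) m) x\<close>
  lies above \<open>x'\<close>, hence above \<open>x\<close>: all positive multiples of \<open>m\<close> are upper. Symmetrically \<open>f^N\<close> moves
  \<open>b\<close> down to \<open>x\<close>, and all positive multiples of \<open>N\<close> are lower. The number \<open>N m\<close> is both, a contradiction.

  The structure of dendrites used here rests on two facts. Compact locally connected metric spaces
  are locally path connected (Mazurkiewicz and Moore), and a path that bypasses a point of an arc
  between the same ends produces a simple closed curve; so, in a dendrite, every interior point of an
  arc separates its ends.
\<close>

section \<open>Compact locally connected metric spaces are locally path connected\<close>

text \<open>
  A chain is kept constant from
  index \<open>N\<close> on, instead of stopping there, so that chains of different lengths can be padded to a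
  common length.
\<close>

definition chain :: "'a::metric_space set \<Rightarrow> real \<Rightarrow> nat \<Rightarrow> (nat \<Rightarrow> 'a) \<Rightarrow> 'a \<Rightarrow> 'a \<Rightarrow> bool" where
  "chain X d N P u v \<longleftrightarrow>
     (\<forall>i. P i \<in> X \<and> dist (P i) (P (Suc i)) < d) \<and> P 0 = u \<and> (\<forall>i\<ge>N. P i = v) \<and> 0 < N"

text \<open>
  Being joined by a chain is an equivalence relation with open classes, so a connected set has one class.
\<close>

lemma connected_imp_chain:
  assumes C: "connected C" and u: "u \<in> C" and v: "v \<in> C" and d: "0 < d"
  shows "\<exists>N P. chain C d N P u v"
proof -
  define R where "R = {(x, y). x \<in> C \<and> y \<in> C \<and> dist x y < d}"
  have "(u, v) \<in> R\<^sup>*"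
  proof (rule connected_equivalence_relation[OF C u v, of "\<lambda>x y. (x, y) \<in> R\<^sup>*"])
    have "sym R" by (auto simp: R_def sym_def dist_commute)
    then show "\<And>x y. (x, y) \<in> R\<^sup>* \<Longrightarrow> (y, x) \<in> R\<^sup>*"
      by (metis sym_rtrancl symD)
    show "\<And>x y z. (x, y) \<in> R\<^sup>* \<Longrightarrow> (y, z) \<in> R\<^sup>* \<Longrightarrow> (x, z) \<in> R\<^sup>*" by (rule rtrancl_trans)
    fix a assume a: "a \<in> C"
    show "\<exists>T. openin (top_of_set C) T \<and> a \<in> T \<and> (\<forall>x\<in>T. (a, x) \<in> R\<^sup>*)"
      by (rule exI[of _ "C \<inter> ball a d"]) (use a d in \<open>auto simp: R_def openin_open\<close>)
  qed
  then obtain n where "(u, v) \<in> R ^^ n" by (metis rtrancl_imp_relpow)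
  then obtain F where F: "F 0 = u" "F n = v" "\<And>i. i < n \<Longrightarrow> (F i, F (Suc i)) \<in> R"
    unfolding relpow_fun_conv by blast
  define P where "P i = (if i \<le> n then F i else v)" for i
  have "P i \<in> C \<and> dist (P i) (P (Suc i)) < d" for i
  proof (cases "i < n")
    case True
    then show ?thesis using F(3)[OF True] by (auto simp: P_def R_def)
  next
    case False
    then have "P i = v" "P (Suc i) = v" using F(2) by (auto simp: P_def)
    then show ?thesis using v d by auto
  qed
  then have "chain C d (Suc n) P u v"
    using F(1) by (auto simp: chain_def P_def)
  then show ?thesis by blast
qed

text \<open>
  Each jump of the coarse chain is replaced by a finer chain, all of the same length \<open>M\<close>; so entry \<open>j\<close> of
  the refinement belongs to entry \<open>j div M\<close> of the coarse chain, and stays close to it.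
\<close>

lemma chain_refine:
  assumes ch: "chain X d N P u v" and e: "0 < e"
    and sub: "\<And>x y. x \<in> X \<Longrightarrow> y \<in> X \<Longrightarrow> dist x y < d \<Longrightarrow>
                \<exists>M c. chain X d' M c x y \<and> (\<forall>i. dist x (c i) < e)"
    and d': "0 < d'"
  shows "\<exists>M P'. 0 < M \<and> chain X d' (N * M) P' u v \<and> (\<forall>j. dist (P (j div M)) (P' j) < e)"
proof -
  have "\<forall>i. \<exists>M c. chain X d' M c (P i) (P (Suc i)) \<and> (\<forall>j. dist (P i) (c j) < e)"
    using ch sub unfolding chain_def by blast
  then obtain K c where c: "\<And>i. chain X d' (K i) (c i) (P i) (P (Suc i))"
    and ce: "\<And>i j. dist (P i) (c i j) < e"
    by metis
  define M where "M = Suc (Max (K ` {..N}))"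
  have KM: "K i \<le> M" if "i < N" for i
    unfolding M_def using that by (intro le_SucI Max_ge) auto
  have M: "0 < M" by (simp add: M_def)
  have N: "0 < N" and PN: "\<And>i. i \<ge> N \<Longrightarrow> P i = v" and PX: "\<And>i. P i \<in> X"
    using ch by (simp_all add: chain_def)
  have vX: "v \<in> X" using PX[of N] PN[of N] by simp
  define P' where "P' j = (if j div M < N then c (j div M) (j mod M) else v)" for j
  have step: "P' j \<in> X \<and> dist (P' j) (P' (Suc j)) < d'" for j
  proof (cases "j div M < N")
    case True
    let ?i = "j div M"
    have ci: "c ?i k \<in> X" "dist (c ?i k) (c ?i (Suc k)) < d'" for k
      using c[of ?i] by (auto simp: chain_def)
    show ?thesis
    proof (cases "Suc (j mod M) < M")
      case True
      then have "Suc j div M = ?i" "Suc j mod M = Suc (j mod M)"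
        by (auto simp: div_Suc mod_Suc)
      then show ?thesis using \<open>?i < N\<close> ci by (simp add: P'_def)
    next
      case False
      then have eq: "Suc (j mod M) = M" using M by (meson mod_less_divisor Suc_lessI)
      then have s: "Suc j div M = Suc ?i" "Suc j mod M = 0" by (auto simp: div_Suc mod_Suc)
      have "c ?i M = P (Suc ?i)" using c[of ?i] KM[OF \<open>?i < N\<close>] by (auto simp: chain_def)
      moreover have "P' (Suc j) = P (Suc ?i)"
        using s PN[of "Suc ?i"] c[of "Suc ?i"] by (auto simp: P'_def chain_def)
      ultimately show ?thesis using \<open>?i < N\<close> ci[of "j mod M"] eq by (simp add: P'_def)
    qed
  next
    case False
    moreover have "j div M \<le> Suc j div M" by (intro div_le_mono) auto
    ultimately have "\<not> Suc j div M < N" by linarith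
    then show ?thesis using False vX d' by (auto simp: P'_def)
  qed
  have "P' 0 = u" using N c[of 0] ch by (auto simp: P'_def chain_def)
  moreover have "P' i = v" if "i \<ge> N * M" for i
  proof -
    have "N \<le> i div M" using that M by (simp add: less_eq_div_iff_mult_less_eq)
    then show ?thesis by (simp add: P'_def)
  qed
  ultimately have "chain X d' (N * M) P' u v"
    using step M N by (auto simp: chain_def)
  moreover have "dist (P (j div M)) (P' j) < e" for j
    using ce PN e by (auto simp: P'_def)
  ultimately show ?thesis using M by blast
qed

text \<open>
  The bound \<open>d\<close> is a Lebesgue number of a cover by small connected relatively open sets.
\<close>

lemma uniformly_locally_connected:
  fixes X :: "'a::metric_space set"
  assumes "compact X" "locally connected X" "0 < e"
  shows "\<exists>d>0. \<forall>x\<in>X. \<forall>y\<in>X. dist x y < d \<longrightarrow>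
           (\<exists>C. C \<subseteq> X \<and> connected C \<and> x \<in> C \<and> y \<in> C \<and> (\<forall>z\<in>C. dist x z < e))"
proof -
  define GG where "GG = {G. open G \<and> connected (X \<inter> G) \<and> (\<forall>x\<in>X\<inter>G. \<forall>z\<in>X\<inter>G. dist x z < e)}"
  have "X \<subseteq> \<Union>GG"
  proof
    fix x assume x: "x \<in> X"
    have "openin (top_of_set X) (X \<inter> ball x (e/2))" by auto
    then obtain U where U: "openin (top_of_set X) U" "connected U" "x \<in> U" "U \<subseteq> X \<inter> ball x (e/2)"
      using assms(2) x \<open>0 < e\<close> unfolding locally_connected
      by (metis (no_types, lifting) IntI centre_in_ball half_gt_zero)
    then obtain G where G: "open G" "U = X \<inter> G" by (auto simp: openin_open)
    have "\<forall>y\<in>X\<inter>G. \<forall>z\<in>X\<inter>G. dist y z < e"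
      using U(4) G(2) by (auto intro: dist_triangle_half_r[of x] simp: subset_iff)
    then have "G \<in> GG" using G U by (auto simp: GG_def)
    then show "x \<in> \<Union>GG" using U G by auto
  qed
  then obtain d where d: "0 < d" "\<And>x. x \<in> X \<Longrightarrow> \<exists>G\<in>GG. ball x d \<subseteq> G"
    using Heine_Borel_lemma[OF assms(1), of GG] by (metis (no_types, lifting) GG_def mem_Collect_eq)
  show ?thesis
  proof (intro exI[of _ d] conjI ballI impI d(1))
    fix x y assume "x \<in> X" "y \<in> X" "dist x y < d"
    then obtain G where "G \<in> GG" "x \<in> G" "y \<in> G"
      using d by (meson centre_in_ball mem_ball subsetD)
    then show "\<exists>C\<subseteq>X. connected C \<and> x \<in> C \<and> y \<in> C \<and> (\<forall>z\<in>C. dist x z < e)"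
      using \<open>x \<in> X\<close> \<open>y \<in> X\<close> by (intro exI[of _ "X \<inter> G"]) (auto simp: GG_def)
  qed
qed

lemma nat_floor_scale:
  assumes "0 \<le> (x::real)" "0 < M"
  shows "nat \<lfloor>x * real M\<rfloor> div M = nat \<lfloor>x\<rfloor>"
proof -
  have "\<lfloor>x * real M\<rfloor> div int M = \<lfloor>x\<rfloor>"
    using floor_divide_real_eq_div[of "int M" "x * real M"] assms by simp
  then show ?thesis
    by (metis nat_div_distrib' nat_int of_nat_0_le_iff)
qed

text \<open>
  Read the chain \<open>P k\<close> as a step function on the unit interval with \<open>N k\<close> steps. Since \<open>N k\<close> divides
  \<open>N (k + 1)\<close>, consecutive step functions differ by at most \<open>r / 2 ^ (k + 1)\<close> everywhere, and so they converge
  uniformly. The limit is continuous because the jumps of the step functions tend to zero.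
\<close>

lemma path_from_refining_chains:
  fixes X :: "'a::metric_space set"
  assumes X: "compact X" and r: "0 < r"
    and ch: "\<And>k. chain X (d k) (N k) (P k) u v"
    and d: "\<And>k. d k \<le> r / 2 ^ k"
    and N: "\<And>k. \<exists>M>0. N (Suc k) = N k * M \<and> (\<forall>j. dist (P k (j div M)) (P (Suc k) j) < r / 2 ^ Suc k)"
  shows "\<exists>p. path p \<and> path_image p \<subseteq> X \<and> pathstart p = u \<and> pathfinish p = v \<and>
             (\<forall>t\<in>{0..1}. \<exists>j. dist (P 0 j) (p t) \<le> r)"
proof -
  define q where "q k t = P k (nat \<lfloor>t * real (N k)\<rfloor>)" for k and t :: real
  have qX: "q k t \<in> X" for k t using ch by (auto simp: q_def chain_def)
  have q1: "dist (q k t) (q (Suc k) t) < r / 2 ^ Suc k" if "0 \<le> t" for k t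
  proof -
    obtain M where M: "M > 0" "N (Suc k) = N k * M"
      "\<forall>j. dist (P k (j div M)) (P (Suc k) j) < r / 2 ^ Suc k"
      using N by blast
    have "nat \<lfloor>t * real (N (Suc k))\<rfloor> div M = nat \<lfloor>t * real (N k)\<rfloor>"
      using nat_floor_scale[of "t * real (N k)" M] M that by (simp add: mult.assoc)
    then show ?thesis using M(3) unfolding q_def by metis
  qed
  have q2: "dist (q k t) (q (k + n) t) \<le> r / 2 ^ k - r / 2 ^ (k + n)" if "0 \<le> t" for k n t
  proof (induction n)
    case (Suc n)
    have "dist (q k t) (q (k + Suc n) t)
        \<le> dist (q k t) (q (k + n) t) + dist (q (k + n) t) (q (Suc (k + n)) t)"
      using dist_triangle by simp
    also have "\<dots> \<le> r / 2 ^ k - r / 2 ^ (k + n) + r / 2 ^ Suc (k + n)"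
      using Suc q1[OF that, of "k + n"] by linarith
    also have "\<dots> = r / 2 ^ k - r / 2 ^ (k + Suc n)" by (simp add: field_simps)
    finally show ?case .
  qed simp
  have q3: "dist (q k t) (q (k + n) t) \<le> r / 2 ^ k" if "0 \<le> t" for k n t
    using q2[OF that, of k n] r by (smt (verit) divide_pos_pos zero_less_power)
  have small: "\<exists>k. r / 2 ^ k < e" if "0 < e" for e
  proof -
    have "(\<lambda>k. r / 2 ^ k) \<longlonglongrightarrow> 0" by (rule LIMSEQ_divide_realpow_zero) simp
    then have "\<forall>\<^sub>F k in sequentially. r / 2 ^ k < e" using that by (rule order_tendstoD)
    then show ?thesis by (auto simp: eventually_sequentially)
  qed
  have cau: "Cauchy (\<lambda>k. q k t)" if t: "0 \<le> t" for t
  proof (rule metric_CauchyI)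
    fix e :: real assume "0 < e"
    then obtain k where k: "r / 2 ^ k < e / 2" using small[of "e/2"] by auto
    show "\<exists>M. \<forall>m\<ge>M. \<forall>n\<ge>M. dist (q m t) (q n t) < e"
    proof (intro exI[of _ k] allI impI)
      fix m n assume "m \<ge> k" "n \<ge> k"
      then have "dist (q k t) (q m t) \<le> r / 2 ^ k" "dist (q k t) (q n t) \<le> r / 2 ^ k"
        using q3[OF t, of k "m - k"] q3[OF t, of k "n - k"] by simp_all
      then have "dist (q k t) (q m t) < e/2" "dist (q k t) (q n t) < e/2"
        using k by linarith+
      then show "dist (q m t) (q n t) < e" by (metis dist_triangle_half_r)
    qed
  qed
  have "\<exists>l\<in>X. (\<lambda>k. q k t) \<longlonglongrightarrow> l" if "0 \<le> t" for t
    using completeE[OF compact_imp_complete[OF X] _ cau[OF that]] qX by metis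
  then obtain p where pX: "\<And>t. 0 \<le> t \<Longrightarrow> p t \<in> X" and p: "\<And>t. 0 \<le> t \<Longrightarrow> (\<lambda>k. q k t) \<longlonglongrightarrow> p t"
    by metis
  have pq: "dist (q k t) (p t) \<le> r / 2 ^ k" if t: "0 \<le> t" for k t
  proof (rule Lim_bounded)
    show "(\<lambda>n. dist (q k t) (q n t)) \<longlonglongrightarrow> dist (q k t) (p t)"
      by (intro tendsto_intros p t)
    show "\<forall>n\<ge>k. dist (q k t) (q n t) \<le> r / 2 ^ k"
      using q3[OF t, of k] by (metis le_add_diff_inverse)
  qed
  have jump: "dist (q k s) (q k t) \<le> r / 2 ^ k"
    if st: "0 \<le> s" "s \<le> t" "t < s + 1 / real (N k)" for k s t
  proof -
    have Nk: "0 < N k" using ch by (auto simp: chain_def)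
    let ?a = "nat \<lfloor>s * real (N k)\<rfloor>" and ?b = "nat \<lfloor>t * real (N k)\<rfloor>"
    have "s * real (N k) \<le> t * real (N k)" using st by (intro mult_right_mono) auto
    moreover have "t * real (N k) < s * real (N k) + 1"
    proof -
      have "t * real (N k) < (s + 1 / real (N k)) * real (N k)"
        using st Nk by (intro mult_strict_right_mono) auto
      then show ?thesis using Nk by (simp add: distrib_right)
    qed
    moreover have "0 \<le> s * real (N k)" using st by simp
    ultimately have "?b = ?a \<or> ?b = Suc ?a" by linarith
    moreover have "dist (P k ?a) (P k (Suc ?a)) \<le> r / 2 ^ k"
      using ch[of k] d[of k] unfolding chain_def by (meson less_le_trans less_imp_le)
    ultimately show ?thesis using r by (auto simp: q_def)
  qed
  have "continuous_on {0..1} p"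
    unfolding continuous_on_iff
  proof (intro ballI allI impI)
    fix t e :: real assume t: "t \<in> {0..1}" and e: "0 < e"
    obtain k where k: "r / 2 ^ k < e / 3" using small[of "e/3"] e by auto
    have Nk: "0 < N k" using ch by (auto simp: chain_def)
    show "\<exists>d>0. \<forall>s\<in>{0..1}. dist s t < d \<longrightarrow> dist (p s) (p t) < e"
    proof (intro exI[of _ "1 / real (N k)"] conjI ballI impI)
      fix s assume s: "s \<in> {0..1}" and st: "dist s t < 1 / real (N k)"
      have "dist (q k s) (q k t) \<le> r / 2 ^ k"
      proof (cases "s \<le> t")
        case True then show ?thesis using jump[of s t k] s st by (auto simp: dist_real_def)
      next
        case False then show ?thesis using jump[of t s k] t st by (auto simp: dist_real_def dist_commute)
      qed
      moreover have "dist (q k s) (p s) \<le> r / 2 ^ k" "dist (q k t) (p t) \<le> r / 2 ^ k"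
        using pq s t by auto
      moreover have "dist (p s) (p t) \<le> dist (q k s) (p s) + dist (q k s) (q k t) + dist (q k t) (p t)"
        by (metis add.commute add.left_commute dist_commute dist_triangle_le dist_triangle add_left_mono)
      ultimately show "dist (p s) (p t) < e" using k by linarith
    qed (use Nk in auto)
  qed
  moreover have "p 0 = u"
  proof -
    have "q k 0 = u" for k using ch by (auto simp: q_def chain_def)
    then show ?thesis using p[of 0] by (simp add: LIMSEQ_const_iff)
  qed
  moreover have "p 1 = v"
  proof -
    have "q k 1 = v" for k using ch by (auto simp: q_def chain_def)
    then show ?thesis using p[of 1] by (simp add: LIMSEQ_const_iff)
  qed
  moreover have "\<exists>j. dist (P 0 j) (p t) \<le> r" if "t \<in> {0..1}" for t
    using pq[of t 0] that by (auto simp: q_def)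
  ultimately show ?thesis
    using pX by (intro exI[of _ p]) (auto simp: path_def path_image_def pathstart_def pathfinish_def)
qed

text \<open>
  By uniform local connectedness, two points at distance less than \<open>d k\<close> lie in a connected set of size
  about \<open>s / 2 ^ (k + 1)\<close>, and such a set contains chains with jumps below \<open>d (k + 1)\<close>. Starting from the one-step
  chain between two close points, repeated refinement yields a path that stays near them.
\<close>

lemma compact_locally_connected_imp_locally_path_connected:
  fixes X :: "'a::metric_space set"
  assumes X: "compact X" and lc: "locally connected X"
  shows "locally path_connected X"
proof -
  have main: "\<exists>d>0. \<forall>u\<in>X. \<forall>v\<in>X. dist u v < d \<longrightarrow>
       (\<exists>p. path p \<and> path_image p \<subseteq> X \<inter> cball u r \<and> pathstart p = u \<and> pathfinish p = v)"
    if "0 < r" for r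
  proof -
    define s where "s = r / 2"
    have s: "0 < s" using that by (simp add: s_def)
    have "\<exists>d. 0 < d \<and> d \<le> s / 2 ^ k \<and> (\<forall>x\<in>X. \<forall>y\<in>X. dist x y < d \<longrightarrow>
        (\<exists>C. C \<subseteq> X \<and> connected C \<and> x \<in> C \<and> y \<in> C \<and> (\<forall>z\<in>C. dist x z < s / 2 ^ Suc k)))" for k
    proof -
      obtain d where "0 < d" "\<forall>x\<in>X. \<forall>y\<in>X. dist x y < d \<longrightarrow>
        (\<exists>C. C \<subseteq> X \<and> connected C \<and> x \<in> C \<and> y \<in> C \<and> (\<forall>z\<in>C. dist x z < s / 2 ^ Suc k))"
        using uniformly_locally_connected[OF X lc, of "s / 2 ^ Suc k"] s by auto
      then show ?thesis using s by (intro exI[of _ "min d (s / 2 ^ k)"]) auto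
    qed
    then obtain d where d: "\<And>k. 0 < d k" "\<And>k. d k \<le> s / 2 ^ k"
      and dC: "\<And>k x y. x \<in> X \<Longrightarrow> y \<in> X \<Longrightarrow> dist x y < d k \<Longrightarrow>
         \<exists>C. C \<subseteq> X \<and> connected C \<and> x \<in> C \<and> y \<in> C \<and> (\<forall>z\<in>C. dist x z < s / 2 ^ Suc k)"
      by metis
    have sub: "\<exists>M c. chain X (d (Suc k)) M c x y \<and> (\<forall>i. dist x (c i) < s / 2 ^ Suc k)"
      if "x \<in> X" "y \<in> X" "dist x y < d k" for k x y
    proof -
      obtain C where C: "C \<subseteq> X" "connected C" "x \<in> C" "y \<in> C" "\<forall>z\<in>C. dist x z < s / 2 ^ Suc k"
        using dC[OF \<open>x \<in> X\<close> \<open>y \<in> X\<close> \<open>dist x y < d k\<close>] by blast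
      then obtain M c where "chain C (d (Suc k)) M c x y"
        using connected_imp_chain d(1) by metis
      then show ?thesis using C unfolding chain_def by (intro exI[of _ M] exI[of _ c]) auto
    qed
    show ?thesis
    proof (intro exI[of _ "d 0"] conjI ballI impI d(1))
      fix u v assume u: "u \<in> X" and v: "v \<in> X" and uv: "dist u v < d 0"
      define P0 where "P0 i = (if i = 0 then u else v)" for i :: nat
      have "chain X (d 0) 1 P0 u v"
        using u v uv d(1)[of 0] by (auto simp: chain_def P0_def)
      then have "\<exists>F. \<forall>k. (chain X (d k) (fst (F k)) (snd (F k)) u v \<and> (k = 0 \<longrightarrow> F k = (1, P0))) \<and>
          (\<exists>M>0. fst (F (Suc k)) = fst (F k) * M \<and>
             (\<forall>j. dist (snd (F k) (j div M)) (snd (F (Suc k)) j) < s / 2 ^ Suc k))"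
      proof (intro dependent_nat_choice)
        fix x :: "nat \<times> (nat \<Rightarrow> 'a)" and k
        assume "chain X (d k) (fst x) (snd x) u v \<and> (k = 0 \<longrightarrow> x = (1, P0))"
        then obtain M P' where "0 < M" "chain X (d (Suc k)) (fst x * M) P' u v"
          "\<forall>j. dist (snd x (j div M)) (P' j) < s / 2 ^ Suc k"
          using chain_refine[of X "d k" "fst x" "snd x" u v "s / 2 ^ Suc k" "d (Suc k)"] sub s d(1)
          by (metis divide_pos_pos zero_less_numeral zero_less_power)
        then show "\<exists>y. (chain X (d (Suc k)) (fst y) (snd y) u v \<and> (Suc k = 0 \<longrightarrow> y = (1, P0))) \<and>
             (\<exists>M>0. fst y = fst x * M \<and> (\<forall>j. dist (snd x (j div M)) (snd y j) < s / 2 ^ Suc k))"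
          by (intro exI[of _ "(fst x * M, P')"]) auto
      qed auto
      then obtain F where F: "\<And>k. chain X (d k) (fst (F k)) (snd (F k)) u v" "F 0 = (1, P0)"
         "\<And>k. \<exists>M>0. fst (F (Suc k)) = fst (F k) * M \<and>
             (\<forall>j. dist (snd (F k) (j div M)) (snd (F (Suc k)) j) < s / 2 ^ Suc k)"
        by metis
      obtain p where p: "path p" "path_image p \<subseteq> X" "pathstart p = u" "pathfinish p = v"
        "\<And>t. t \<in> {0..1} \<Longrightarrow> \<exists>j. dist (snd (F 0) j) (p t) \<le> s"
        using path_from_refining_chains[OF X s F(1) d(2) F(3)] by blast
      have "dist u (p t) \<le> r" if t: "t \<in> {0..1}" for t
      proof -
        obtain j where j: "dist (P0 j) (p t) \<le> s"
          using p(5)[OF t] unfolding F(2) snd_conv by blast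
        moreover have "dist u (P0 j) \<le> s" using uv d(2)[of 0] s by (auto simp: P0_def)
        ultimately show ?thesis unfolding s_def using dist_triangle[of u "p t" "P0 j"] by linarith
      qed
      then show "\<exists>p. path p \<and> path_image p \<subseteq> X \<inter> cball u r \<and> pathstart p = u \<and> pathfinish p = v"
        using p by (intro exI[of _ p]) (auto simp: path_image_def)
    qed
  qed
  show ?thesis
    unfolding locally_path_connected_im_kleinen
  proof (intro allI impI, elim conjE)
    fix V x assume V: "openin (top_of_set X) V" and x: "x \<in> V"
    then obtain e where e: "0 < e" "ball x e \<inter> X \<subseteq> V" by (auto simp: openin_contains_ball)
    have xX: "x \<in> X" using V x openin_imp_subset by auto
    obtain d where d: "d > 0" and dp: "\<forall>u\<in>X. \<forall>v\<in>X. dist u v < d \<longrightarrow>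
       (\<exists>p. path p \<and> path_image p \<subseteq> X \<inter> cball u (e/2) \<and> pathstart p = u \<and> pathfinish p = v)"
      using main[of "e/2"] e by auto
    have sub: "X \<inter> cball x (e/2) \<subseteq> V" using e by auto
    show "\<exists>u. openin (top_of_set X) u \<and> x \<in> u \<and> u \<subseteq> V \<and>
           (\<forall>y. y \<in> u \<longrightarrow> (\<exists>p. path p \<and> path_image p \<subseteq> V \<and> pathstart p = x \<and> pathfinish p = y))"
    proof (intro exI[of _ "V \<inter> ball x d"] conjI allI impI)
      show "openin (top_of_set X) (V \<inter> ball x d)" using V by (simp add: openin_Int_open)
      fix y assume "y \<in> V \<inter> ball x d"
      then have "y \<in> X" "dist x y < d" using V openin_imp_subset by auto
      then show "\<exists>p. path p \<and> path_image p \<subseteq> V \<and> pathstart p = x \<and> pathfinish p = y"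
        using dp xX sub by (meson subset_trans)
    qed (use x d in auto)
  qed
qed

section \<open>Arcs and simple loops in metric spaces\<close>

text \<open>
  Sending \<open>x\<close> to the function \<open>dist x\<close>, shifted by \<open>dist x0\<close> to make it bounded, is an isometry into a Banach
  space. Statements about paths that are available in Banach spaces thereby carry over to metric spaces.
\<close>

lemma kuratowski_embedding:
  "\<exists>\<phi> :: 'a::metric_space \<Rightarrow> ('a \<Rightarrow>\<^sub>C real). \<forall>x y. dist (\<phi> x) (\<phi> y) = dist x y"
proof -
  fix x0 :: 'a
  define \<psi> where "\<psi> x y = dist x y - dist x0 y" for x y :: 'a
  define \<phi> where "\<phi> x = Bcontfun (\<psi> x)" for x
  have bc: "\<psi> x \<in> bcontfun" for x
  proof (rule bcontfun_normI[of _ "dist x x0"])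
    show "continuous_on UNIV (\<psi> x)" unfolding \<psi>_def by (intro continuous_intros)
    show "norm (\<psi> x y) \<le> dist x x0" for y
      using dist_triangle[of x y x0] dist_triangle3[of x0 y x] by (auto simp: \<psi>_def)
  qed
  have app: "apply_bcontfun (\<phi> x) y = dist x y - dist x0 y" for x y
    unfolding \<phi>_def Bcontfun_inverse[OF bc] by (simp add: \<psi>_def)
  have "dist (\<phi> x) (\<phi> y) = dist x y" for x y
  proof (rule antisym)
    show "dist (\<phi> x) (\<phi> y) \<le> dist x y"
    proof (rule dist_bound)
      fix z show "dist (\<phi> x z) (\<phi> y z) \<le> dist x y"
        using dist_triangle[of x z y] dist_triangle3[of y z x] by (auto simp: app dist_real_def)
    qed
    show "dist x y \<le> dist (\<phi> x) (\<phi> y)"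
      using dist_bounded[of "\<phi> x" y "\<phi> y"] by (simp add: app dist_real_def)
  qed
  then show ?thesis by blast
qed

lemma isometry_continuous_on:
  assumes "\<And>x y. dist (\<phi> x) (\<phi> y) = dist x y"
  shows "continuous_on S \<phi>"
  unfolding continuous_on_iff assms by blast

lemma isometry_inverse_continuous_on:
  assumes "\<And>x y. dist (\<phi> x) (\<phi> y) = dist x y" and "S \<subseteq> range \<phi>"
  shows "continuous_on S (inv \<phi>)"
proof -
  have "inj \<phi>" using assms(1) by (metis dist_eq_0_iff injI)
  then show ?thesis
    unfolding continuous_on_iff using assms by (metis f_inv_into_f subsetD)
qed

lemma path_contains_arc_metric:
  fixes p :: "real \<Rightarrow> 'a::metric_space"
  assumes p: "path p" and ne: "pathstart p \<noteq> pathfinish p"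
  shows "\<exists>q. arc q \<and> path_image q \<subseteq> path_image p \<and>
             pathstart q = pathstart p \<and> pathfinish q = pathfinish p"
proof -
  obtain \<phi> :: "'a \<Rightarrow> ('a \<Rightarrow>\<^sub>C real)" where iso: "\<And>x y. dist (\<phi> x) (\<phi> y) = dist x y"
    using kuratowski_embedding by blast
  have inj: "inj \<phi>" using iso by (metis dist_eq_0_iff injI)
  have "path (\<phi> \<circ> p)" using p isometry_continuous_on[OF iso] by (rule path_continuous_image)
  moreover have "\<phi> (pathstart p) \<noteq> \<phi> (pathfinish p)" using ne inj by (simp add: inj_eq)
  ultimately obtain q where q: "arc q" "path_image q \<subseteq> path_image (\<phi> \<circ> p)"
    "pathstart q = \<phi> (pathstart p)" "pathfinish q = \<phi> (pathfinish p)"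
    using path_contains_arc[of "\<phi> \<circ> p" "\<phi> (pathstart p)" "\<phi> (pathfinish p)"]
    by (metis pathfinish_compose pathstart_compose)
  have sub: "path_image q \<subseteq> \<phi> ` path_image p" using q(2) by (simp add: path_image_compose)
  have "path (inv \<phi> \<circ> q)"
    using q(1) sub by (intro path_continuous_image isometry_inverse_continuous_on[OF iso])
      (auto simp: arc_imp_path)
  moreover have "inj_on (inv \<phi> \<circ> q) {0..1}"
    using q(1) sub by (intro comp_inj_on inj_on_inv_into)
      (auto simp: arc_def path_image_def)
  moreover have "path_image (inv \<phi> \<circ> q) \<subseteq> path_image p"
    using sub inj by (auto simp: path_image_compose)
  ultimately show ?thesis
    using q inj by (intro exI[of _ "inv \<phi> \<circ> q"]) (simp add: arc_def pathstart_compose pathfinish_compose)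
qed

text \<open>
  Replace the path \<open>h\<close> by an arc \<open>q\<close> inside it. Starting at \<open>p\<close>, follow \<open>g\<close> in both directions until \<open>q\<close> is met
  for the first time. The piece of \<open>g\<close> between these two points meets \<open>q\<close> only at its ends, so it
  closes up with the piece of \<open>q\<close> between them.
\<close>

lemma bypassed_arc_gives_simple_loop_normed:
  fixes g h :: "real \<Rightarrow> 'a::{complete_space,real_normed_vector}"
  assumes g: "arc g" and h: "path h" and ends: "pathstart h = pathstart g" "pathfinish h = pathfinish g"
    and p: "p \<in> path_image g" "p \<notin> path_image h"
  shows "\<exists>c. simple_path c \<and> pathfinish c = pathstart c \<and> path_image c \<subseteq> path_image g \<union> path_image h"
proof -
  have "pathstart h \<noteq> pathfinish h" using g ends by (metis arc_distinct_ends)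
  then obtain q where q: "arc q" "path_image q \<subseteq> path_image h"
     "pathstart q = pathstart g" "pathfinish q = pathfinish g"
    using path_contains_arc[OF h] ends by metis
  obtain t0 where t0: "t0 \<in> {0..1}" "g t0 = p" using p by (auto simp: path_image_def)
  define T where "T = {0..1} \<inter> g -` path_image q"
  have ginj: "\<And>s t. s \<in> {0..1} \<Longrightarrow> t \<in> {0..1} \<Longrightarrow> g s = g t \<Longrightarrow> s = t"
    using g by (auto simp: arc_def inj_on_def)
  have "closed T"
    unfolding T_def using g q(1)
    by (intro continuous_closed_preimage) (auto simp: arc_def path_def closed_arc_image)
  have T01: "0 \<in> T" "1 \<in> T"
    using q by (auto simp: T_def, metis pathstart_def pathstart_in_path_image, metis pathfinish_def pathfinish_in_path_image)
  have t0T: "t0 \<notin> T" using t0 p q(2) by (auto simp: T_def)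
  have cA: "compact (T \<inter> {0..t0})" and cB: "compact (T \<inter> {t0..1})"
    using \<open>closed T\<close> by (auto intro: closed_Int_compact)
  obtain s where s: "s \<in> T" "s \<le> t0" "\<And>x. x \<in> T \<Longrightarrow> 0 \<le> x \<Longrightarrow> x \<le> t0 \<Longrightarrow> x \<le> s"
    using compact_attains_sup[OF cA] T01 t0 by fastforce
  obtain s' where s': "s' \<in> T" "t0 \<le> s'" "\<And>x. x \<in> T \<Longrightarrow> t0 \<le> x \<Longrightarrow> x \<le> 1 \<Longrightarrow> s' \<le> x"
    using compact_attains_inf[OF cB] T01 t0 by fastforce
  have lt: "s < t0" "t0 < s'" using s s' t0T by (auto simp: less_le)
  have I: "s \<in> {0..1}" "s' \<in> {0..1}" using s s' by (auto simp: T_def)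
  obtain \<sigma> \<sigma>' where \<sigma>: "\<sigma> \<in> {0..1}" "q \<sigma> = g s" "\<sigma>' \<in> {0..1}" "q \<sigma>' = g s'"
    using s(1) s'(1) by (auto simp: T_def path_image_def)
  have ne: "\<sigma> \<noteq> \<sigma>'" using \<sigma>(2,4) ginj[OF I] lt by auto
  define g1 where "g1 = subpath s s' g"
  define g2 where "g2 = subpath \<sigma>' \<sigma> q"
  have a1: "arc g1" and a2: "arc g2"
    unfolding g1_def g2_def using arc_subpath_arc[OF g I] arc_subpath_arc[OF q(1) \<sigma>(3,1)] lt ne by auto
  have im1: "path_image g1 = g ` {s..s'}" using lt by (simp add: g1_def path_image_subpath)
  have im2: "path_image g2 \<subseteq> path_image q" using \<sigma> by (simp add: g2_def path_image_subpath_subset)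
  have "path_image g1 \<inter> path_image g2 \<subseteq> {g s, g s'}"
  proof
    fix y assume "y \<in> path_image g1 \<inter> path_image g2"
    then obtain x where x: "s \<le> x" "x \<le> s'" "y = g x" "g x \<in> path_image q"
      using im1 im2 by fastforce
    then have "x \<in> T" using I by (auto simp: T_def)
    then have "x = s \<or> x = s'"
      using s(3)[of x] s'(3)[of x] x I by (cases "x \<le> t0") auto
    then show "y \<in> {g s, g s'}" using x by auto
  qed
  then have "simple_path (g1 +++ g2)"
    using a1 a2 \<sigma> by (intro simple_path_join_loop) (auto simp: g1_def g2_def)
  moreover have "path_image (g1 +++ g2) \<subseteq> path_image g \<union> path_image h"
    using path_image_join_subset[of g1 g2] im2 q(2) path_image_subpath_subset[OF I, of g]
    by (auto simp: g1_def)
  moreover have "pathfinish (g1 +++ g2) = pathstart (g1 +++ g2)"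
    using \<sigma> by (simp add: g1_def g2_def)
  ultimately show ?thesis by blast
qed

lemma bypassed_arc_gives_simple_loop:
  fixes g h :: "real \<Rightarrow> 'a::metric_space"
  assumes g: "arc g" and h: "path h" and ends: "pathstart h = pathstart g" "pathfinish h = pathfinish g"
    and p: "p \<in> path_image g" "p \<notin> path_image h"
  shows "\<exists>c. simple_path c \<and> pathfinish c = pathstart c \<and> path_image c \<subseteq> path_image g \<union> path_image h"
proof -
  obtain \<phi> :: "'a \<Rightarrow> ('a \<Rightarrow>\<^sub>C real)" where iso: "\<And>x y. dist (\<phi> x) (\<phi> y) = dist x y"
    using kuratowski_embedding by blast
  have inj: "inj \<phi>" using iso by (metis dist_eq_0_iff injI)
  note cont = isometry_continuous_on[OF iso]
  have "arc (\<phi> \<circ> g)"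
    using g inj by (auto simp: arc_def intro!: path_continuous_image cont comp_inj_on intro: inj_on_subset)
  moreover have "path (\<phi> \<circ> h)" by (intro path_continuous_image cont h)
  moreover have "\<phi> p \<in> path_image (\<phi> \<circ> g)" "\<phi> p \<notin> path_image (\<phi> \<circ> h)"
    using p inj by (auto simp: path_image_compose inj_eq)
  ultimately obtain c where c: "simple_path c" "pathfinish c = pathstart c"
    "path_image c \<subseteq> path_image (\<phi> \<circ> g) \<union> path_image (\<phi> \<circ> h)"
    using bypassed_arc_gives_simple_loop_normed[of "\<phi> \<circ> g" "\<phi> \<circ> h" "\<phi> p"] ends
    by (auto simp: pathstart_compose pathfinish_compose)
  have sub: "path_image c \<subseteq> \<phi> ` (path_image g \<union> path_image h)"
    using c(3) by (auto simp: path_image_compose)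
  have "path (inv \<phi> \<circ> c)"
    using c(1) sub by (intro path_continuous_image isometry_inverse_continuous_on[OF iso])
      (auto simp: simple_path_def)
  moreover have "loop_free (inv \<phi> \<circ> c)"
  proof -
    have "c x = c y" if "x \<in> {0..1}" "y \<in> {0..1}" "inv \<phi> (c x) = inv \<phi> (c y)" for x y
    proof -
      have "c x \<in> range \<phi>" "c y \<in> range \<phi>" using sub that unfolding path_image_def by blast+
      then show ?thesis using that(3) by (metis f_inv_into_f)
    qed
    then show ?thesis using c(1) unfolding simple_path_def loop_free_def comp_def by blast
  qed
  moreover have "path_image (inv \<phi> \<circ> c) \<subseteq> path_image g \<union> path_image h"
    using sub inj by (auto simp: path_image_compose)
  ultimately show ?thesis using c(2)
    by (intro exI[of _ "inv \<phi> \<circ> c"]) (simp add: simple_path_def pathstart_compose pathfinish_compose)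
qed

section \<open>Betweenness in a dendrite\<close>

text \<open>
  In a dendrite this is the arc from \<open>u\<close> to \<open>v\<close>. Defined through connected sets, it makes \<open>p \<notin> seg X u v\<close>
  say that \<open>u\<close> and \<open>v\<close> can be joined by a connected set avoiding \<open>p\<close>, which is transitive
  in \<open>u\<close> and \<open>v\<close>. For fixed \<open>z\<close>, the relation \<open>x \<in> seg X z y\<close> is the order of the tree rooted at \<open>z\<close>.
\<close>

definition seg :: "'a::topological_space set \<Rightarrow> 'a \<Rightarrow> 'a \<Rightarrow> 'a set" where
  "seg X u v = {p \<in> X. \<forall>C. C \<subseteq> X \<longrightarrow> connected C \<longrightarrow> u \<in> C \<longrightarrow> v \<in> C \<longrightarrow> p \<in> C}"

lemma segD: "p \<in> seg X u v \<Longrightarrow> C \<subseteq> X \<Longrightarrow> connected C \<Longrightarrow> u \<in> C \<Longrightarrow> v \<in> C \<Longrightarrow> p \<in> C"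
  by (auto simp: seg_def)

lemma seg_subset: "seg X u v \<subseteq> X"
  by (auto simp: seg_def)

lemma seg_commute: "seg X u v = seg X v u"
  by (auto simp: seg_def)

lemma seg_ends: "u \<in> X \<Longrightarrow> u \<in> seg X u v" "v \<in> X \<Longrightarrow> v \<in> seg X u v"
  by (auto simp: seg_def)

lemma seg_refl: "u \<in> X \<Longrightarrow> seg X u u = {u}"
  using segD[of _ X u u "{u}"] seg_ends by fastforce

lemma seg_order_trans: "x \<in> seg X z y \<Longrightarrow> y \<in> seg X z w \<Longrightarrow> x \<in> seg X z w"
  unfolding seg_def by blast

lemma not_seg_trans:
  assumes "p \<notin> seg X u v" "p \<notin> seg X v w"
  shows "p \<notin> seg X u w"
proof (cases "p \<in> X")
  case True
  obtain C where C: "C \<subseteq> X" "connected C" "u \<in> C" "v \<in> C" "p \<notin> C"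
    using assms(1) True by (auto simp: seg_def)
  obtain D where D: "D \<subseteq> X" "connected D" "v \<in> D" "w \<in> D" "p \<notin> D"
    using assms(2) True by (auto simp: seg_def)
  have "connected (C \<union> D)" using C D by (intro connected_Un) auto
  then show ?thesis using C D segD[of p X u w "C \<union> D"] by auto
qed (auto simp: seg_def)

locale dendrite_space =
  fixes X :: "'a::metric_space set"
  assumes dendrite: "dendrite X"
begin

lemma compact_X: "compact X" and connected_X: "connected X" and locally_connected_X: "locally connected X"
  using dendrite by (auto simp: dendrite_def)

lemma no_simple_loop: "simple_path c \<Longrightarrow> pathfinish c = pathstart c \<Longrightarrow> \<not> path_image c \<subseteq> X"
  using dendrite unfolding dendrite_def jordan_curve_def by blast

lemma locally_path_connected_X: "locally path_connected X"
  by (rule compact_locally_connected_imp_locally_path_connected[OF compact_X locally_connected_X])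

lemma connected_open_join:
  assumes "openin (top_of_set X) U" "C \<subseteq> U" "connected C" "u \<in> C" "v \<in> C"
  shows "\<exists>h. path h \<and> path_image h \<subseteq> U \<and> pathstart h = u \<and> pathfinish h = v"
proof -
  have "locally path_connected U"
    using locally_open_subset[OF locally_path_connected_X assms(1)] .
  then have "path_component_set U u = connected_component_set U u"
    by (rule path_component_eq_connected_component_set)
  moreover have "connected_component U u v" using assms by (auto simp: connected_component_def)
  ultimately show ?thesis by (auto simp: path_component_def)
qed

lemma arc_exists:
  assumes "u \<in> X" "v \<in> X" "u \<noteq> v"
  obtains g where "arc g" "path_image g \<subseteq> X" "g 0 = u" "g 1 = v"
proof -
  obtain h where h: "path h" "path_image h \<subseteq> X" "pathstart h = u" "pathfinish h = v"
    using connected_open_join[of X X u v] connected_X assms by auto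
  obtain q where "arc q" "path_image q \<subseteq> path_image h" "pathstart q = u" "pathfinish q = v"
    using path_contains_arc_metric[OF h(1)] h(3,4) assms(3) by auto
  then show ?thesis using that[of q] h(2) by (auto simp: pathstart_def pathfinish_def)
qed

text \<open>
  If a connected set containing the ends missed an interior point \<open>p\<close> of the arc, a path between the ends
  would exist in the open set \<open>X - {p}\<close> by local path connectedness. Such a bypass yields a Jordan curve.
\<close>

lemma seg_arc:
  assumes g: "arc g" and gX: "path_image g \<subseteq> X"
  shows "seg X (g 0) (g 1) = path_image g"
proof
  show "seg X (g 0) (g 1) \<subseteq> path_image g"
    using segD[OF _ gX connected_arc_image[OF g]]
    by (metis subsetI pathstart_def pathfinish_def pathstart_in_path_image pathfinish_in_path_image)
  show "path_image g \<subseteq> seg X (g 0) (g 1)"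
  proof
    fix p assume p: "p \<in> path_image g"
    have "p \<in> C" if C: "C \<subseteq> X" "connected C" "g 0 \<in> C" "g 1 \<in> C" for C
    proof (rule ccontr)
      assume "p \<notin> C"
      then have "C \<subseteq> X - {p}" using C by auto
      moreover have "openin (top_of_set X) (X - {p})"
        by (auto simp: openin_open intro!: exI[of _ "- {p}"])
      ultimately obtain h where h: "path h" "path_image h \<subseteq> X - {p}" "pathstart h = g 0" "pathfinish h = g 1"
        using connected_open_join[of "X - {p}" C "g 0" "g 1"] C by auto
      have "p \<notin> path_image h" using h(2) by auto
      then have "\<exists>c. simple_path c \<and> pathfinish c = pathstart c \<and>
          path_image c \<subseteq> path_image g \<union> path_image h"
        using h(3,4) by (intro bypassed_arc_gives_simple_loop[OF g h(1) _ _ p])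
          (simp_all add: pathstart_def pathfinish_def)
      then obtain c where "simple_path c" "pathfinish c = pathstart c"
        "path_image c \<subseteq> path_image g \<union> path_image h" by blast
      then show False using no_simple_loop gX h(2) by blast
    qed
    then show "p \<in> seg X (g 0) (g 1)" using p gX by (auto simp: seg_def)
  qed
qed

text \<open>
  A connected set containing \<open>g s\<close> and \<open>g t\<close>, extended by the two outer pieces of the arc, joins the ends
  of the whole arc and therefore covers it.
\<close>

lemma seg_subarc:
  assumes g: "arc g" and gX: "path_image g \<subseteq> X" and st: "0 \<le> s" "s \<le> t" "t \<le> 1"
  shows "seg X (g s) (g t) = g ` {s..t}"
proof
  have cont: "continuous_on {0..1} g" using g by (auto simp: arc_def path_def)
  have ginj: "\<And>x y. x \<in> {0..1} \<Longrightarrow> y \<in> {0..1} \<Longrightarrow> g x = g y \<Longrightarrow> x = y"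
    using g by (auto simp: arc_def inj_on_def)
  have con: "connected (g ` {x..y})" if "0 \<le> x" "y \<le> 1" for x y
    using that by (intro connected_continuous_image continuous_on_subset[OF cont]) auto
  have sub: "g ` {x..y} \<subseteq> X" if "0 \<le> x" "y \<le> 1" for x y
    using that gX by (auto simp: path_image_def)
  show "seg X (g s) (g t) \<subseteq> g ` {s..t}"
    using segD[OF _ sub con] st by auto
  show "g ` {s..t} \<subseteq> seg X (g s) (g t)"
  proof
    fix p assume "p \<in> g ` {s..t}"
    then obtain x where x: "s \<le> x" "x \<le> t" "p = g x" by auto
    have "p \<in> C" if C: "C \<subseteq> X" "connected C" "g s \<in> C" "g t \<in> C" for C
    proof -
      let ?D = "g ` {0..s} \<union> C \<union> g ` {t..1}"
      have ne: "g ` {0..s} \<inter> C \<noteq> {}" "(g ` {0..s} \<union> C) \<inter> g ` {t..1} \<noteq> {}"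
        using C(3,4) st by force+
      then have "connected ?D"
        using C st by (intro connected_Un con) auto
      moreover have "?D \<subseteq> X" using sub[of 0 s] sub[of t 1] C st by auto
      moreover have "g 0 \<in> ?D" "g 1 \<in> ?D" using st by auto
      moreover have "p \<in> seg X (g 0) (g 1)"
        using x st unfolding seg_arc[OF g gX] by (auto simp: path_image_def)
      ultimately have pD: "p \<in> ?D" using segD by blast
      \<comment> \<open>The outer pieces of the arc meet \<open>g ` {s..t}\<close> only in \<open>g s\<close> and \<open>g t\<close>.\<close>
      have eq_s: "x = s" if "p \<in> g ` {0..s}"
      proof -
        obtain r where "0 \<le> r" "r \<le> s" "g x = g r" using \<open>p \<in> g ` {0..s}\<close> x by auto
        then show ?thesis using ginj[of x r] x st by auto
      qed
      have eq_t: "x = t" if "p \<in> g ` {t..1}"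
      proof -
        obtain r where "t \<le> r" "r \<le> 1" "g x = g r" using \<open>p \<in> g ` {t..1}\<close> x by auto
        then show ?thesis using ginj[of x r] x st by auto
      qed
      from pD consider "p \<in> g ` {0..s}" | "p \<in> C" | "p \<in> g ` {t..1}" by blast
      then show "p \<in> C"
      proof cases
        case 1
        then have "x = s" by (rule eq_s)
        then show ?thesis using C(3) x(3) by simp
      next
        case 3
        then have "x = t" by (rule eq_t)
        then show ?thesis using C(4) x(3) by simp
      qed
    qed
    then show "p \<in> seg X (g s) (g t)" using x st sub[of s t] by (auto simp: seg_def)
  qed
qed

lemma seg_compact_connected:
  assumes "u \<in> X" "v \<in> X"
  shows "compact (seg X u v)" "connected (seg X u v)"
proof -
  have "compact (seg X u v) \<and> connected (seg X u v)"
  proof (cases "u = v")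
    case False
    then obtain g where "arc g" "path_image g \<subseteq> X" "g 0 = u" "g 1 = v"
      using arc_exists assms by metis
    then show ?thesis using seg_arc[of g] compact_arc_image connected_arc_image by auto
  next
    case True
    then show ?thesis using seg_refl[OF assms(1)] by simp
  qed
  then show "compact (seg X u v)" "connected (seg X u v)" by auto
qed

lemma seg_antisym:
  assumes "z \<in> X" "y \<in> X" "x \<in> seg X z y" "y \<in> seg X z x"
  shows "x = y"
proof (cases "z = y")
  case True
  then show ?thesis using assms seg_refl by auto
next
  case False
  then obtain g where g: "arc g" "path_image g \<subseteq> X" "g 0 = z" "g 1 = y"
    using arc_exists assms by metis
  then obtain t where t: "t \<in> {0..1}" "x = g t"
    using assms(3) seg_arc[OF g(1,2)] by (auto simp: path_image_def)
  have "g 1 \<in> g ` {0..t}"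
    using seg_subarc[OF g(1,2), of 0 t] t assms(4) g by auto
  then obtain r where "r \<in> {0..t}" "g r = g 1" by auto
  moreover from this have "r = 1" using t inj_onD[OF arc_imp_inj_on[OF g(1)], of r 1] by auto
  ultimately have "t = 1" using t by auto
  then show ?thesis using t g by simp
qed

lemma not_seg_beyond:
  assumes "z \<in> X" "p \<in> X" "y \<in> seg X z p" "y \<noteq> z"
  shows "z \<notin> seg X y p"
  using seg_antisym[of p z y] assms seg_commute by metis

text \<open>
  With respect to the tree order rooted at \<open>u\<close>, going on from \<open>y\<close> to a later point \<open>w\<close> never leads back through an
  earlier point \<open>x\<close>: the set joining \<open>u\<close> to \<open>x\<close> without \<open>y\<close> shows that \<open>y\<close> lies between \<open>x\<close> and \<open>w\<close>.
\<close>

lemma not_seg_later: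
  assumes X: "u \<in> X" "w \<in> X" and x: "x \<in> seg X u y" and y: "y \<in> seg X u w" and ne: "x \<noteq> y"
  shows "x \<notin> seg X y w"
proof -
  have X': "x \<in> X" "y \<in> X" using x y seg_subset by auto
  have "y \<notin> seg X u x" using seg_antisym[OF X(1) X'(2) x] ne by auto
  then have "y \<in> seg X x w" using y not_seg_trans by metis
  then show ?thesis using not_seg_beyond X X' ne by auto
qed

lemma locally_connected_pairs:
  assumes "0 < e"
  obtains d where "0 < d" "\<And>x y. x \<in> X \<Longrightarrow> y \<in> X \<Longrightarrow> dist x y < d \<Longrightarrow>
    \<exists>C. C \<subseteq> X \<and> connected C \<and> x \<in> C \<and> y \<in> C \<and> (\<forall>z\<in>C. dist x z < e)"
  using uniformly_locally_connected[OF compact_X locally_connected_X assms] by metis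

lemma closed_X: "closed X"
  using compact_X by (rule compact_imp_closed)

text \<open>
  Betweenness is a closed relation. If \<open>p'\<close> is off the compact set \<open>seg X u v'\<close>, then adding to it a small
  connected set around \<open>v'\<close> joins \<open>u\<close> to all points \<open>v k\<close> near \<open>v'\<close> and still avoids a ball around \<open>p'\<close>.
\<close>

lemma seg_limit:
  assumes u: "u \<in> X" and pk: "\<And>k. p k \<in> seg X u (v k)" and vk: "\<And>k. v k \<in> X"
    and lim: "p \<longlonglongrightarrow> p'" "v \<longlonglongrightarrow> v'"
  shows "p' \<in> seg X u v'"
proof (rule ccontr)
  assume n: "p' \<notin> seg X u v'"
  have v': "v' \<in> X" using closed_X vk lim(2) closed_sequentially by blast
  have K: "compact (seg X u v')" "connected (seg X u v')" using seg_compact_connected u v' by auto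
  have "open (- seg X u v')" using K(1) by (simp add: compact_imp_closed open_Compl)
  then obtain e where e: "0 < e" "ball p' e \<subseteq> - seg X u v'"
    using n openE by blast
  obtain d where d: "0 < d" "\<And>x y. x \<in> X \<Longrightarrow> y \<in> X \<Longrightarrow> dist x y < d \<Longrightarrow>
    \<exists>C. C \<subseteq> X \<and> connected C \<and> x \<in> C \<and> y \<in> C \<and> (\<forall>z\<in>C. dist x z < e/2)"
    using locally_connected_pairs[of "e/2"] e(1) by auto
  have "\<forall>\<^sub>F k in sequentially. dist (p k) p' < e/2 \<and> dist (v k) v' < d"
    using tendstoD[OF lim(1), of "e/2"] tendstoD[OF lim(2), of d] e d by (auto intro: eventually_conj)
  then obtain k where k: "dist (p k) p' < e/2" "dist (v k) v' < d"
    by (auto simp: eventually_sequentially)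
  obtain W where W: "W \<subseteq> X" "connected W" "v' \<in> W" "v k \<in> W" "\<And>z. z \<in> W \<Longrightarrow> dist v' z < e/2"
    using d(2)[OF v' vk[of k]] k(2) by (auto simp: dist_commute)
  have vs: "v' \<in> seg X u v'" "u \<in> seg X u v'" using seg_ends u v' by auto
  have "connected (seg X u v' \<union> W)" using K W vs by (intro connected_Un) auto
  then have "p k \<in> seg X u v' \<union> W"
    using segD[OF pk[of k], of "seg X u v' \<union> W"] seg_subset W vs by auto
  then show False
  proof
    assume "p k \<in> seg X u v'"
    then show False using e k(1) by (auto simp: dist_commute subset_iff)
  next
    assume "p k \<in> W"
    then have "dist v' p' < e" using W(5) k(1) by (metis dist_commute dist_triangle_half_r)
    then show False using e vs by (auto simp: dist_commute subset_iff)
  qed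
qed

section \<open>Fixed points in branches\<close>

text \<open>
  If \<open>x\<close> is below \<open>F x\<close> in the tree order rooted at \<open>z\<close>, then so is a point \<open>y\<close> just after \<open>x\<close> on the arc towards
  \<open>F x\<close>: the point \<open>F y\<close> is so close to \<open>F x\<close> that a small connected set not containing \<open>y\<close> joins the two, so
  \<open>y\<close> separates \<open>z\<close> from \<open>F y\<close> just as it separates \<open>z\<close> from \<open>F x\<close>.
\<close>

lemma order_extension:
  assumes F: "continuous_on X F" "F ` X \<subseteq> X" and z: "z \<in> X" and x: "x \<in> X"
    and xF: "x \<in> seg X z (F x)" and ne: "x \<noteq> F x"
  obtains y where "y \<in> X" "y \<noteq> x" "x \<in> seg X z y" "y \<in> seg X z (F y)" "y \<in> seg X z (F x)"
proof -
  have FX: "F x \<in> X" using F x by auto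
  obtain h where h: "arc h" "path_image h \<subseteq> X" "h 0 = x" "h 1 = F x"
    using arc_exists[OF x FX ne] .
  define e where "e = dist x (F x) / 2"
  have e: "0 < e" using ne by (simp add: e_def)
  obtain d where d: "0 < d" "\<And>x y. x \<in> X \<Longrightarrow> y \<in> X \<Longrightarrow> dist x y < d \<Longrightarrow>
    \<exists>C. C \<subseteq> X \<and> connected C \<and> x \<in> C \<and> y \<in> C \<and> (\<forall>z\<in>C. dist x z < e)"
    using locally_connected_pairs[OF e] by metis
  have hc: "continuous_on {0..1} h" using h by (auto simp: arc_def path_def)
  have hX: "h t \<in> X" if "t \<in> {0..1}" for t using h that by (auto simp: path_image_def)
  have Fh: "continuous_on {0..1} (\<lambda>t. F (h t))"
    using continuous_on_compose2[OF F(1) hc] hX by blast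
  have 0: "(0::real) \<in> {0..1}" by simp
  obtain d1 where d1: "0 < d1" "\<And>t. t \<in> {0..1} \<Longrightarrow> dist t 0 < d1 \<Longrightarrow> dist (h t) x < e"
    using hc 0 e h(3) unfolding continuous_on_iff by metis
  obtain d2 where d2: "0 < d2" "\<And>t. t \<in> {0..1} \<Longrightarrow> dist t 0 < d2 \<Longrightarrow> dist (F (h t)) (F x) < d"
    using Fh 0 d(1) h(3) unfolding continuous_on_iff by metis
  define t where "t = min (1/2) (min d1 d2 / 2)"
  have t: "0 < t" "t < 1" "dist t 0 < d1" "dist t 0 < d2"
    using d1(1) d2(1) by (auto simp: t_def dist_real_def min_def)
  define y where "y = h t"
  have hinj: "\<And>s t. s \<in> {0..1} \<Longrightarrow> t \<in> {0..1} \<Longrightarrow> h s = h t \<Longrightarrow> s = t"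
    using h by (auto simp: arc_def inj_on_def)
  have yX: "y \<in> X" and yx: "y \<noteq> x" and dyx: "dist y x < e" and dF: "dist (F y) (F x) < d"
    using t hX d1 d2 hinj[of t 0] h by (auto simp: y_def)
  have Fy: "F y \<in> X" using F yX by auto
  have yseg: "y \<in> seg X x (F x)"
    using seg_arc[OF h(1,2)] h t by (auto simp: y_def path_image_def)
  have xy: "x \<notin> seg X y (F x)" using not_seg_beyond[OF x FX yseg yx] .
  have 1: "x \<in> seg X z y" using xF xy not_seg_trans by metis
  have 2: "y \<in> seg X z (F x)"
  proof -
    have "y \<in> C" if C: "C \<subseteq> X" "connected C" "z \<in> C" "F x \<in> C" for C
      using segD[OF xF C] segD[OF yseg, of C] C by auto
    then show ?thesis using yX by (auto simp: seg_def)
  qed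
  obtain W where W: "W \<subseteq> X" "connected W" "F x \<in> W" "F y \<in> W" "\<And>z. z \<in> W \<Longrightarrow> dist (F x) z < e"
    using d(2)[OF FX Fy] dF by (auto simp: dist_commute)
  have "y \<notin> W"
  proof
    assume "y \<in> W"
    then have "dist x (F x) < e + e"
      using W(5) dyx by (metis add_strict_mono dist_commute dist_triangle_lt)
    then show False by (simp add: e_def)
  qed
  then have "y \<notin> seg X (F y) (F x)" using segD[of y X "F y" "F x" W] W by auto
  then have 3: "y \<in> seg X z (F y)" using 2 not_seg_trans by metis
  show ?thesis using that yX yx 1 2 3 by blast
qed

text \<open>
  A point that is maximal, in the tree order rooted at \<open>z\<close>, among the points \<open>x\<close> below \<open>F x\<close> must be a fixed
  point, by \<open>order_extension\<close>. Maximal points exist because the order is closed and \<open>X\<close> is compact.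
  Searching only above a first point \<open>y0\<close> on the way from \<open>z\<close> to \<open>F z\<close> keeps the fixed point in the
  component of \<open>X - {z}\<close> that contains \<open>F z\<close>.
\<close>

lemma fixed_point_in_branch:
  assumes F: "continuous_on X F" "F ` X \<subseteq> X" and z: "z \<in> X"
  obtains p where "p \<in> X" "F p = p" "p = z \<or> z \<notin> seg X p (F z)"
proof (cases "F z = z")
  case True
  then show ?thesis using that z by blast
next
  case False
  have "z \<in> seg X z (F z)" using seg_ends z by auto
  then obtain y0 where y0: "y0 \<in> X" "y0 \<noteq> z" "y0 \<in> seg X z (F y0)" "y0 \<in> seg X z (F z)"
    using order_extension[OF F z z] False by metis
  define S where "S = {x \<in> X. y0 \<in> seg X z x \<and> x \<in> seg X z (F x)}"
  have up_closed: "closed {x \<in> S. c \<in> seg X z x}" for c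
    unfolding closed_sequential_limits
  proof (intro allI impI, elim conjE)
    fix w l assume w: "\<forall>n::nat. w n \<in> {x \<in> S. c \<in> seg X z x}" and l: "w \<longlonglongrightarrow> l"
    have wX: "\<And>n. w n \<in> X" using w by (auto simp: S_def)
    have lX: "l \<in> X" using closed_X wX l closed_sequentially by blast
    have "(\<lambda>n. F (w n)) \<longlonglongrightarrow> F l"
      using F(1) wX lX l unfolding continuous_on_sequentially comp_def by blast
    then have "l \<in> seg X z (F l)"
      using seg_limit[OF z, of w "\<lambda>n. F (w n)" l "F l"] w wX l F(2) by (auto simp: S_def)
    moreover have "y0 \<in> seg X z l"
      using seg_limit[OF z, of "\<lambda>_. y0" w y0 l] w wX l by (auto simp: S_def)
    moreover have "c \<in> seg X z l"
      using seg_limit[OF z, of "\<lambda>_. c" w c l] w wX l by auto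
    ultimately show "l \<in> {x \<in> S. c \<in> seg X z x}" using lX by (auto simp: S_def)
  qed
  have SX: "S \<subseteq> X" by (auto simp: S_def)
  have y0S: "y0 \<in> S" using y0 seg_ends by (auto simp: S_def)
  have "\<exists>m\<in>S. \<forall>x\<in>S. m \<in> seg X z x \<longrightarrow> x = m"
  proof (rule predicate_Zorn)
    show "partial_order_on S (relation_of (\<lambda>x y. x \<in> seg X z y) S)"
    proof (rule partial_order_on_relation_ofI)
      show "x \<in> seg X z x" if "x \<in> S" for x using that SX seg_ends(2) by blast
      show "x \<in> seg X z w" if "x \<in> seg X z y" "y \<in> seg X z w" for x y w
        using that seg_order_trans by metis
      show "x = y" if "x \<in> S" "y \<in> S" "x \<in> seg X z y" "y \<in> seg X z x" for x y
        using that SX z seg_antisym by auto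
    qed
    fix C assume C: "C \<in> Chains (relation_of (\<lambda>x y. x \<in> seg X z y) S)"
    have CS: "C \<subseteq> S" and Ccomp: "\<And>x y. x \<in> C \<Longrightarrow> y \<in> C \<Longrightarrow> x \<in> seg X z y \<or> y \<in> seg X z x"
      using C by (auto simp: Chains_def relation_of_def)
    show "\<exists>u\<in>S. \<forall>c\<in>C. c \<in> seg X z u"
    proof (cases "C = {}")
      case True
      then show ?thesis using y0S by auto
    next
      case False
      define T where "T c = {x \<in> S. c \<in> seg X z x}" for c
      have top: "\<exists>m\<in>C'. \<forall>c\<in>C'. c \<in> seg X z m" if "finite C'" "C' \<noteq> {}" "C' \<subseteq> C" for C'
        using that
      proof (induction C' rule: finite_ne_induct)
        case (singleton c)
        then have "c \<in> X" using CS SX by auto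
        then show ?case using seg_ends(2) by blast
      next
        case (insert c C')
        then obtain m where m: "m \<in> C'" "\<forall>c\<in>C'. c \<in> seg X z m" by auto
        have "c \<in> X" using insert.prems CS SX by auto
        then have cX: "c \<in> seg X z c" by (rule seg_ends(2))
        show ?case
        proof (cases "c \<in> seg X z m")
          case True
          then show ?thesis using m by auto
        next
          case False
          then have "m \<in> seg X z c" using Ccomp insert.prems m by blast
          then show ?thesis using m cX seg_order_trans by (metis insert_iff)
        qed
      qed
      have "X \<inter> (\<Inter>c\<in>C. T c) \<noteq> {}"
      proof (rule compact_imp_fip_image[OF compact_X])
        show "closed (T c)" for c using up_closed by (simp add: T_def)
        fix C' assume C': "finite C'" "C' \<subseteq> C"
        show "X \<inter> (\<Inter>c\<in>C'. T c) \<noteq> {}"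
        proof (cases "C' = {}")
          case True
          then show ?thesis using z by auto
        next
          case False
          then obtain m where "m \<in> C'" "\<forall>c\<in>C'. c \<in> seg X z m" using top C' by metis
          then have "m \<in> X \<inter> (\<Inter>c\<in>C'. T c)" using C' CS SX by (auto simp: T_def)
          then show ?thesis by auto
        qed
      qed
      then show ?thesis using False by (auto simp: T_def)
    qed
  qed
  then obtain m where m: "m \<in> S" "\<And>x. x \<in> S \<Longrightarrow> m \<in> seg X z x \<Longrightarrow> x = m" by blast
  have mX: "m \<in> X" "y0 \<in> seg X z m" "m \<in> seg X z (F m)" using m by (auto simp: S_def)
  have "F m = m"
  proof (rule ccontr)
    assume "F m \<noteq> m"
    then obtain y where "y \<in> X" "y \<noteq> m" "m \<in> seg X z y" "y \<in> seg X z (F y)"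
      using order_extension[OF F z mX(1,3)] by metis
    moreover have "y \<in> S" using calculation seg_order_trans[OF mX(2)] by (auto simp: S_def)
    ultimately show False using m(2) by blast
  qed
  moreover have "z \<notin> seg X m (F z)"
  proof (rule not_seg_trans)
    show "z \<notin> seg X m y0" using not_seg_beyond[OF z mX(1,2) y0(2)] seg_commute by metis
    show "z \<notin> seg X y0 (F z)" using not_seg_beyond[OF z _ y0(4,2)] F(2) z by auto
  qed
  ultimately show ?thesis using that mX by blast
qed

section \<open>Branches along an arc\<close>

text \<open>
  Points \<open>p n\<close> in branches at \<open>g (t n)\<close>, with \<open>t n\<close> tending to \<open>1\<close>, that stay away from \<open>g 1\<close> would accumulate at
  some other point \<open>q\<close>. Two of them in different branches are then joined by a small connected set near \<open>q\<close>; but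
  it has to pass through the foot \<open>g (t n)\<close> of one of the branches, which is near \<open>g 1\<close>.
\<close>

lemma branches_shrink:
  assumes g: "arc g" and gX: "path_image g \<subseteq> X" and e: "0 < e"
  shows "\<exists>s. 0 \<le> s \<and> s < 1 \<and> (\<forall>t p. s < t \<longrightarrow> t < 1 \<longrightarrow> p \<in> X \<longrightarrow>
     g t \<in> seg X (g 0) p \<longrightarrow> g t \<in> seg X (g 1) p \<longrightarrow> dist p (g 1) < e)"
proof (rule ccontr)
  assume no: "\<not> ?thesis"
  have ex: "\<exists>t p. s < t \<and> t < 1 \<and> p \<in> X \<and> g t \<in> seg X (g 0) p \<and> g t \<in> seg X (g 1) p \<and> e \<le> dist p (g 1)"
    if "0 \<le> s" "s < 1" for s
    using no that by (meson not_le)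
  have "\<exists>t p. 1 - 1 / real (Suc n) < t \<and> t < 1 \<and> p \<in> X \<and> g t \<in> seg X (g 0) p \<and>
       g t \<in> seg X (g 1) p \<and> e \<le> dist p (g 1)" for n
    by (rule ex) simp_all
  then obtain t p where t: "\<And>n. 1 - 1 / real (Suc n) < t n" "\<And>n. t n < 1" and pX: "\<And>n. p n \<in> X"
    and tp: "\<And>n. g (t n) \<in> seg X (g 0) (p n)" "\<And>n. g (t n) \<in> seg X (g 1) (p n)"
    and far: "\<And>n. e \<le> dist (p n) (g 1)"
    by metis
  obtain q r where q: "q \<in> X" and r: "strict_mono r" and lim: "(p \<circ> r) \<longlonglongrightarrow> q"
    using compact_X pX unfolding compact_def by metis
  have t0: "0 \<le> t n" for n
    using t(1)[of n] by (smt (verit) divide_le_eq_1_pos of_nat_0_less_iff of_nat_Suc of_nat_0_le_iff zero_less_Suc)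
  have tlim: "t \<longlonglongrightarrow> 1"
  proof (rule tendsto_sandwich)
    have "(\<lambda>n. 1 - 1 / real (Suc n)) \<longlonglongrightarrow> 1 - 0"
      by (intro tendsto_diff tendsto_const LIMSEQ_Suc[OF lim_1_over_n])
    then show "(\<lambda>n. 1 - 1 / real (Suc n)) \<longlonglongrightarrow> 1" by simp
    show "(\<lambda>n. 1::real) \<longlonglongrightarrow> 1" by simp
  qed (use t in \<open>auto simp: less_imp_le intro!: always_eventually\<close>)
  then have trlim: "(\<lambda>n. t (r n)) \<longlonglongrightarrow> 1"
    using r LIMSEQ_subseq_LIMSEQ unfolding comp_def by blast
  have gc: "continuous_on {0..1} g" using g by (auto simp: arc_def path_def)
  have glim: "(\<lambda>n. g (t (r n))) \<longlonglongrightarrow> g 1"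
    using continuous_on_tendsto_compose[OF gc trlim] t t0 by (auto simp: less_imp_le)
  have "(\<lambda>n. dist ((p \<circ> r) n) (g 1)) \<longlonglongrightarrow> dist q (g 1)" by (intro tendsto_intros lim)
  then have qfar: "e \<le> dist q (g 1)"
    by (rule Lim_bounded2) (use far in auto)
  obtain d where d: "0 < d" "\<And>x y. x \<in> X \<Longrightarrow> y \<in> X \<Longrightarrow> dist x y < d \<Longrightarrow>
    \<exists>C. C \<subseteq> X \<and> connected C \<and> x \<in> C \<and> y \<in> C \<and> (\<forall>z\<in>C. dist x z < e/2)"
    using locally_connected_pairs[of "e/2"] e by (metis half_gt_zero)
  have ev1: "\<forall>\<^sub>F n in sequentially. dist (p (r n)) q < d"
    using tendstoD[OF lim d(1)] by simp
  have ev2: "\<forall>\<^sub>F n in sequentially. dist (g (t (r n))) (g 1) < e/2"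
    using tendstoD[OF glim, of "e/2"] e by simp
  obtain n where n: "dist (p (r n)) q < d" "dist (g (t (r n))) (g 1) < e/2"
    using eventually_conj[OF ev1 ev2] by (auto simp: eventually_sequentially)
  have ev3: "\<forall>\<^sub>F m in sequentially. t (r n) < t (r m)"
    using order_tendstoD(1)[OF trlim] t(2) by blast
  obtain m where m: "dist (p (r m)) q < d" "t (r n) < t (r m)"
    using eventually_conj[OF ev1 ev3] by (auto simp: eventually_sequentially)
  define z z' where "z = g (t (r n))" and "z' = g (t (r m))"
  have ginj: "\<And>s t. s \<in> {0..1} \<Longrightarrow> t \<in> {0..1} \<Longrightarrow> g s = g t \<Longrightarrow> s = t"
    using g by (auto simp: arc_def inj_on_def)
  have g01: "g 0 \<in> X" "g 1 \<in> X" using gX by (auto simp: path_image_def)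
  have ti: "0 \<le> t (r n)" "t (r m) < 1" using t0 t(2) by auto
  have "z \<noteq> z'" using ginj[of "t (r n)" "t (r m)"] m ti by (auto simp: z_def z'_def)
  moreover have "z \<in> seg X (g 0) z'"
    using seg_subarc[OF g gX, of 0 "t (r m)"] ti m by (auto simp: z_def z'_def)
  \<comment> \<open>The foot \<open>z'\<close> comes after \<open>z\<close>, so the whole branch at \<open>z'\<close> lies beyond \<open>z\<close>, on the side of \<open>g 1\<close>.\<close>
  ultimately have 1: "z \<notin> seg X z' (p (r m))"
    using not_seg_later[OF g01(1) pX] tp(1) by (auto simp: z'_def)
  have 2: "z \<notin> seg X (g 1) z'"
  proof
    assume "z \<in> seg X (g 1) z'"
    then have "z \<in> g ` {t (r m)..1}"
      using seg_subarc[OF g gX, of "t (r m)" 1] ti m seg_commute[of X "g 1"] by (auto simp: z'_def)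
    then obtain x where "t (r m) \<le> x" "x \<le> 1" "g (t (r n)) = g x" by (auto simp: z_def)
    then show False using ginj[of "t (r n)" x] ti m by auto
  qed
  have "z \<in> seg X (p (r m)) (p (r n))"
    using not_seg_trans[OF not_seg_trans[OF 2 1], of "p (r n)"] tp(2)[of "r n"] by (auto simp: z_def)
  moreover obtain C where C: "C \<subseteq> X" "connected C" "q \<in> C" "p (r n) \<in> C" "\<forall>z\<in>C. dist q z < e/2"
    using d(2)[OF q pX] n(1) by (metis dist_commute)
  moreover obtain D where D: "D \<subseteq> X" "connected D" "q \<in> D" "p (r m) \<in> D" "\<forall>z\<in>D. dist q z < e/2"
    using d(2)[OF q pX] m(1) by (metis dist_commute)
  moreover have "connected (C \<union> D)" using C D by (intro connected_Un) auto
  ultimately have "z \<in> C \<union> D" using segD[of z X _ _ "C \<union> D"] by auto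
  then have "dist q z < e/2" using C D by auto
  then have "dist q (g 1) < e"
    using n(2) unfolding z_def by (metis dist_commute dist_triangle_half_r)
  then show False using qfar by simp
qed

section \<open>Periodic points near a recurrent end of an arc\<close>

lemma continuous_on_funpow:
  assumes "continuous_on X f" "f ` X \<subseteq> X"
  shows "continuous_on X (f ^^ n)" "(f ^^ n) ` X \<subseteq> X"
proof -
  have "continuous_on X (f ^^ n) \<and> (f ^^ n) ` X \<subseteq> X"
  proof (induction n)
    case (Suc n)
    then show ?case
      using continuous_on_compose2[OF assms(1), of X "f ^^ n"] assms(2) by (auto simp: comp_def)
  qed simp
  then show "continuous_on X (f ^^ n)" "(f ^^ n) ` X \<subseteq> X" by auto
qed

text \<open>
  The complementary condition, that \<open>F\<close> moves \<open>g t\<close> to the side of \<open>u\<close>, is therefore open in \<open>t\<close>.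
  With \<open>u\<close> an end of the arc these are the lower and upper conditions.
\<close>

lemma closed_not_separated:
  assumes g: "arc g" "path_image g \<subseteq> X" and F: "continuous_on X F" "F ` X \<subseteq> X" and u: "u \<in> X"
  shows "closed {t \<in> {0..1}. g t \<in> seg X u (F (g t))}"
  unfolding closed_sequential_limits
proof (intro allI impI, elim conjE)
  fix w and l :: real
  assume w: "\<forall>n::nat. w n \<in> {t \<in> {0..1}. g t \<in> seg X u (F (g t))}" and l: "w \<longlonglongrightarrow> l"
  have l01: "l \<in> {0..1}"
    using closed_sequentially[of "{0..1::real}" w l] w l by auto
  have gX: "g t \<in> X" if "t \<in> {0..1}" for t using g(2) that by (auto simp: path_image_def)
  have gc: "continuous_on {0..1} g" using g by (auto simp: arc_def path_def)
  have 1: "(\<lambda>n. g (w n)) \<longlonglongrightarrow> g l"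
    using continuous_on_tendsto_compose[OF gc l l01] w by auto
  have 2: "(\<lambda>n. F (g (w n))) \<longlonglongrightarrow> F (g l)"
    using continuous_on_tendsto_compose[OF F(1) 1 gX[OF l01]] w gX by auto
  have "g l \<in> seg X u (F (g l))"
    using seg_limit[OF u _ _ 1 2] w gX F(2) by auto
  then show "l \<in> {t \<in> {0..1}. g t \<in> seg X u (F (g t))}" using l01 by auto
qed

text \<open>
  This carries out the argument on return times described at the beginning. For a parameter \<open>t\<close>, the predicates
  \<open>lo m t\<close> and \<open>up m t\<close> say that \<open>f^m (g t)\<close> lies on the side of \<open>g 0\<close> or of \<open>g 1\<close>, seen from \<open>g t\<close>.
\<close>

lemma periodic_point_near_end:
  assumes f: "continuous_on X f" "f ` X \<subseteq> X"
    and g: "arc g" and gX: "path_image g \<subseteq> X"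
    and n: "\<And>k. (f ^^ n k) (g 1) \<in> path_image g - {g 0, g 1}"
    and lim: "(\<lambda>k. (f ^^ n k) (g 1)) \<longlonglongrightarrow> g 1"
    and e: "0 < e"
  shows "\<exists>p\<in>periodic_points X f. dist p (g 1) < e"
proof (rule ccontr)
  assume no: "\<not> ?thesis"
  note F = continuous_on_funpow[OF f]
  obtain s where s: "0 \<le> s" "s < 1"
    and small: "\<And>t p. s < t \<Longrightarrow> t < 1 \<Longrightarrow> p \<in> X \<Longrightarrow> g t \<in> seg X (g 0) p \<Longrightarrow>
                  g t \<in> seg X (g 1) p \<Longrightarrow> dist p (g 1) < e"
    using branches_shrink[OF g gX e] by metis
  have gI: "g t \<in> X" if "t \<in> {0..1}" for t using gX that by (auto simp: path_image_def)
  have g0: "g 0 \<in> X" and g1: "g 1 \<in> X" using gI by auto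
  have ginj: "\<And>s t. s \<in> {0..1} \<Longrightarrow> t \<in> {0..1} \<Longrightarrow> g s = g t \<Longrightarrow> s = t"
    using g by (auto simp: arc_def inj_on_def)
  have gc: "continuous_on {0..1} g" using g by (auto simp: arc_def path_def)
  define J where "J = {s<..<1}"
  have J01: "J \<subseteq> {0..1}" using s by (auto simp: J_def)
  define lo where "lo m t \<longleftrightarrow> g t \<notin> seg X (g 0) ((f ^^ m) (g t))" for m t
  define up where "up m t \<longleftrightarrow> g t \<notin> seg X (g 1) ((f ^^ m) (g t))" for m t
  have lo_or_up: "lo m t \<or> up m t" if m: "0 < m" and t: "t \<in> J" for m t
  proof (rule ccontr)
    assume "\<not> ?thesis"
    then have n0: "g t \<in> seg X (g 0) ((f ^^ m) (g t))" and n1: "g t \<in> seg X (g 1) ((f ^^ m) (g t))"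
      by (auto simp: lo_def up_def)
    have gt: "g t \<in> X" using gI t J01 by auto
    obtain p where p: "p \<in> X" "(f ^^ m) p = p" "p = g t \<or> g t \<notin> seg X p ((f ^^ m) (g t))"
      using fixed_point_in_branch[OF F gt] by metis
    have "g t \<in> seg X (g 0) p" "g t \<in> seg X (g 1) p"
      using p(3) n0 n1 not_seg_trans seg_ends(2)[OF gt] by metis+
    then have "dist p (g 1) < e" using small p(1) t by (auto simp: J_def)
    moreover have "p \<in> periodic_points X f" using p m by (auto simp: periodic_points_def)
    ultimately show False using no by blast
  qed
  have not_both: "\<not> (lo m t \<and> up m t)" if t: "t \<in> J" for m t
  proof
    assume "lo m t \<and> up m t"
    then have "g t \<notin> seg X (g 0) (g 1)"
      unfolding lo_def up_def using not_seg_trans seg_commute by metis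
    then show False using seg_arc[OF g gX] t J01 by (auto simp: path_image_def)
  qed
  \<comment> \<open>The closed sets where \<open>lo\<close> and \<open>up\<close> fail are disjoint in \<open>J\<close> and cover it.\<close>
  have uniform: "(\<forall>t\<in>J. lo m t) \<or> (\<forall>t\<in>J. up m t)" if m: "0 < m" for m
  proof -
    define A where "A = {t \<in> {0..1}. g t \<in> seg X (g 0) ((f ^^ m) (g t))}"
    define B where "B = {t \<in> {0..1}. g t \<in> seg X (g 1) ((f ^^ m) (g t))}"
    have "closed A" "closed B"
      unfolding A_def B_def using closed_not_separated[OF g gX F] g0 g1 by auto
    moreover have "J \<subseteq> A \<union> B" using not_both J01 by (auto simp: A_def B_def lo_def up_def)
    moreover have "A \<inter> B \<inter> J = {}" using lo_or_up[OF m] by (auto simp: A_def B_def lo_def up_def)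
    moreover have "connected J" by (simp add: J_def)
    ultimately have "A \<inter> J = {} \<or> B \<inter> J = {}" unfolding connected_closed by blast
    then show ?thesis using J01 unfolding A_def B_def lo_def up_def by blast
  qed
  have later: "\<exists>k u. r < u \<and> u < 1 \<and> (f ^^ n k) (g 1) = g u \<and> M < n k"
    if r: "0 \<le> r" "r < 1" for r and M :: nat
  proof -
    \<comment> \<open>Avoiding the first part of the arc makes the parameter exceed \<open>r\<close>; avoiding the initial
      iterates makes the time exceed \<open>M\<close>.\<close>
    define K where "K = g ` {0..r} \<union> ((\<lambda>i. (f ^^ i) (g 1)) ` {..M} - {g 1})"
    have "compact (g ` {0..r})"
      using r by (intro compact_continuous_image continuous_on_subset[OF gc]) auto
    then have "closed K" unfolding K_def by (intro closed_Un compact_imp_closed finite_imp_closed) auto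
    moreover have "g 1 \<notin> K" using ginj[of 1] r by (force simp: K_def)
    ultimately have "\<forall>\<^sub>F k in sequentially. (f ^^ n k) (g 1) \<in> - K"
      using topological_tendstoD[OF lim, of "- K"] by auto
    then obtain k where k: "(f ^^ n k) (g 1) \<notin> K" by (auto simp: eventually_sequentially)
    obtain u where u: "u \<in> {0..1}" "(f ^^ n k) (g 1) = g u" using n[of k] by (auto simp: path_image_def)
    have "r < u" using k u by (force simp: K_def)
    moreover have "u \<noteq> 1" using n[of k] u by auto
    moreover have "M < n k"
    proof (rule ccontr)
      assume "\<not> M < n k"
      then show False using k n[of k] by (auto simp: K_def)
    qed
    ultimately show ?thesis using u by (intro exI[of _ k] exI[of _ u]) auto
  qed
  obtain N u1 where u1: "s < u1" "u1 < 1" "(f ^^ N) (g 1) = g u1" "0 < N"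
    using later[OF s] by metis
  obtain N' u2 where u2: "u1 < u2" "u2 < 1" "(f ^^ N') (g 1) = g u2" "N < N'"
    using later[of u1 N] u1 s by (metis less_eq_real_def order.strict_trans1)
  define m where "m = N' - N"
  have m: "0 < m" using u2 by (simp add: m_def)
  have fm: "(f ^^ m) (g u1) = g u2"
    using u1(3) u2(3,4) by (metis (no_types) comp_apply funpow_add le_add_diff_inverse2 less_imp_le m_def)
  have uJ: "u1 \<in> J" "u2 \<in> J" using u1 u2 by (auto simp: J_def)
  have ups: "\<forall>t\<in>J. up (Suc j * m) t" for j
  proof (induction j)
    case 0
    have "g u1 \<notin> seg X (g 1) (g u2)"
    proof
      assume "g u1 \<in> seg X (g 1) (g u2)"
      then obtain x where "u2 \<le> x" "x \<le> 1" "g u1 = g x"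
        using seg_subarc[OF g gX, of u2 1] seg_commute[of X "g 1"] u1 u2 s by auto
      then show False using ginj[of u1 x] u1 u2 s by auto
    qed
    then have "up m u1" using fm by (simp add: up_def)
    then show ?case using uniform[OF m] not_both uJ by auto
  next
    case (Suc j)
    let ?y = "(f ^^ (Suc j * m)) (g u2)"
    \<comment> \<open>\<open>f^m\<close> takes \<open>g u1\<close> up to \<open>g u2\<close>, where the induction hypothesis applies.\<close>
    have y: "(f ^^ (Suc (Suc j) * m)) (g u1) = ?y"
    proof -
      have "Suc (Suc j) * m = Suc j * m + m" by simp
      then show ?thesis using fm by (simp only: funpow_add comp_apply)
    qed
    have "g u2 \<notin> seg X (g 1) ?y" using Suc uJ by (auto simp: up_def)
    moreover have "g u2 \<in> seg X (g 1) (g u1)"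
      using seg_subarc[OF g gX, of u1 1] seg_commute[of X "g 1"] u1 u2 s by auto
    ultimately have "g u1 \<notin> seg X (g 1) ?y" using seg_order_trans by metis
    then have "up (Suc (Suc j) * m) u1" unfolding up_def y .
    moreover have "0 < Suc (Suc j) * m" using m by simp
    ultimately show ?case using uniform not_both uJ by blast
  qed
  \<comment> \<open>The open condition \<open>lo M\<close> at the end point passes to parameters in \<open>J\<close> near \<open>1\<close>, hence to all of \<open>J\<close>.\<close>
  have lo_from_end: "\<forall>t\<in>J. lo M t" if M: "0 < M" and b: "g 1 \<notin> seg X (g 0) ((f ^^ M) (g 1))" for M
  proof -
    let ?B = "{t \<in> {0..1}. g t \<in> seg X (g 0) ((f ^^ M) (g t))}"
    have "open (- ?B)" using closed_not_separated[OF g gX F g0] by auto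
    moreover have "1 \<in> - ?B" using b by auto
    ultimately obtain d where d: "0 < d" "ball 1 d \<subseteq> - ?B" using openE by blast
    define t where "t = max ((s + 1) / 2) (1 - d / 2)"
    have t: "t \<in> J" "t \<in> ball 1 d" using s d by (auto simp: t_def J_def dist_real_def less_max_iff_disj)
    then have "t \<notin> ?B" "t \<in> {0..1}" using d(2) J01 by blast+
    then have "lo M t" by (auto simp: lo_def)
    then show ?thesis using uniform[OF M] not_both t by blast
  qed
  have los: "\<forall>t\<in>J. lo (Suc j * N) t" for j
  proof (induction j)
    case 0
    have "g 1 \<notin> seg X (g 0) (g u1)"
    proof
      assume "g 1 \<in> seg X (g 0) (g u1)"
      then obtain x where "0 \<le> x" "x \<le> u1" "g 1 = g x"
        using seg_subarc[OF g gX, of 0 u1] u1 s by auto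
      then show False using ginj[of 1 x] u1 s by auto
    qed
    then show ?case using lo_from_end[OF u1(4)] u1(3) by auto
  next
    case (Suc j)
    let ?y = "(f ^^ (Suc j * N)) (g u1)"
    \<comment> \<open>\<open>f^N\<close> takes the end \<open>g 1\<close> down to \<open>g u1\<close>, where the induction hypothesis applies.\<close>
    have y: "(f ^^ (Suc (Suc j) * N)) (g 1) = ?y"
    proof -
      have "Suc (Suc j) * N = Suc j * N + N" by simp
      then show ?thesis using u1(3) by (simp only: funpow_add comp_apply)
    qed
    have "g u1 \<notin> seg X (g 0) ?y" using Suc uJ by (auto simp: lo_def)
    moreover have "g u1 \<in> seg X (g 0) (g 1)"
      using seg_arc[OF g gX] u1 s by (auto simp: path_image_def)
    ultimately have "g 1 \<notin> seg X (g 0) ?y" using seg_order_trans by metis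
    moreover have "0 < Suc (Suc j) * N" using u1(4) by simp
    ultimately show ?case using lo_from_end y by metis
  qed
  have "up (N * m) u1" using ups[of "N - 1"] uJ u1(4) by auto
  moreover have "lo (N * m) u1" using los[of "m - 1"] uJ m by (auto simp: mult.commute)
  ultimately show False using not_both uJ by blast
qed

end

theorem theorem1p9:
  fixes X :: "'a::metric_space set" and f :: "'a \<Rightarrow> 'a"
  assumes "dendrite X"
    and "continuous_on X f"
    and "f ` X \<subseteq> X"
  shows "\<forall>b\<in>X. arc_type_recurrent X f b \<longrightarrow> b \<in> closure (periodic_points X f)"
proof (intro ballI impI)
  fix b assume "b \<in> X" "arc_type_recurrent X f b"
  then obtain a A n where A: "closed_arc a b A" "A \<subseteq> X" "\<And>k. (f ^^ n k) b \<in> A - {a, b}"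
    and lim: "(\<lambda>k. (f ^^ n k) b) \<longlonglongrightarrow> b"
    unfolding arc_type_recurrent_def arc_type_limit_point_def by blast
  then obtain g where g: "arc g" "g 0 = a" "g 1 = b" "path_image g = A"
    unfolding closed_arc_def pathstart_def pathfinish_def by blast
  interpret dendrite_space X using assms(1) by unfold_locales
  show "b \<in> closure (periodic_points X f)"
    unfolding closure_approachable
    using periodic_point_near_end[OF assms(2,3) g(1), of n] A lim g by auto
qed

end
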